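(* Let $b\ge 2$ and $\rho\ge 1$ be integers. Then the sequence $\left(C_b^\rho(n)\right)_{n\ge 0}$ of numbers of $\rho$-color $b$-ary partitions of $n$ satisfies, for all integers $n\ge 0$, $$\sum_{i=0}^\rho(-1)^i\binom{\rho}{i}C_b^\rho(bn-i)=C_b^\rho(n),$$ $$\sum_{i=0}^\rho(-1)^i\binom{\rho}{i}C_b^\rho(bn+r-i)=0\qquad(1\le r\le b-1),$$ where $C_b^\rho(m)=0$ for $m<0$.
   Context: A $\rho$-color $b$-ary partition of $n$ is a finite multiset of colored parts, each being a power $b^j$ ($j\ge0$) with a color in $\{1,\dots,\rho\}$, with sum $n$ (order irrelevant, no restriction on multiplicities); $C_b^\rho(n)$ is the number of these, with $C_b^\rho(0)=1$. Equivalently, $\sum_{n\ge0}C_b^\rho(n)q^n=\prod_{j=0}^\infty\left(1-q^{b^j}\right)^{-\rho}$. *)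

theory Defs
  imports "HOL-Library.Multiset"
begin

text \<open>A colored part is a pair (size, color). The size is stored as the number \<open>b ^ j\<close>
  itself rather than the exponent \<open>j\<close>.\<close>

definition colored_bary_partitions :: "nat \<Rightarrow> nat \<Rightarrow> nat \<Rightarrow> (nat \<times> nat) multiset set" where
  "colored_bary_partitions b \<rho> n =
     {P. (\<forall>(p, c) \<in> set_mset P. (\<exists>j. p = b ^ j) \<and> c \<in> {1..\<rho>}) \<and> sum_mset (image_mset fst P) = n}"

text \<open>The argument is an integer so that the convention of vanishing at negative arguments can be
  stated. For \<open>b \<ge> 1\<close> all parts are positive, so the set counted is finite and its
  cardinality is meaningful.\<close>

definition num_colored_bary_partitions :: "nat \<Rightarrow> nat \<Rightarrow> int \<Rightarrow> int" where
  "num_colored_bary_partitions b \<rho> m =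
     (if m < 0 then 0 else int (card (colored_bary_partitions b \<rho> (nat m))))"

end

theory Submission
  imports Defs
begin

text \<open>
  Write \<open>m\<close> for \<open>b * n + r\<close>. The alternating sum is an inclusion-exclusion over sets of colors:
  the \<open>\<rho> choose i\<close> stands for the choice of a set \<open>S\<close> of \<open>i\<close> colors, and adding one part of size
  \<open>1\<close> in each color of \<open>S\<close> turns the partitions of \<open>m - i\<close> into the partitions of \<open>m\<close> in which
  all colors of \<open>S\<close> occur on parts of size \<open>1\<close>
  (\<open>card_partitions_with_unit_parts\<close>). So a partition \<open>P\<close> of \<open>m\<close> contributes \<open>(-1) ^ card S\<close> for
  each set \<open>S\<close> of colors of its unit parts. These signs cancel unless \<open>P\<close> has no unit part at all,
  and the sum counts the partitions of \<open>m\<close> without unit parts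
  (\<open>alternating_sum_eq_card_without_unit_parts\<close>).

  In such a partition every part is a multiple of \<open>b\<close>. This is impossible if \<open>b\<close> does not divide
  \<open>m\<close>; if \<open>m = b * n\<close>, dividing all parts by \<open>b\<close> gives exactly the partitions of \<open>n\<close>.

  On generating functions, this is the identity
  \<open>(1 - q) ^ \<rho> * F q = F (q ^ b)\<close> for \<open>F q = (\<Prod>j. (1 - q ^ (b ^ j)) powi (- \<rho>))\<close>.
\<close>

section \<open>Alternating sums over subsets\<close>

lemma sum_Pow_alternating:
  assumes "finite A"
  shows "(\<Sum>S\<in>Pow A. (-1) ^ card S :: int) = (if A = {} then 1 else 0)"
proof -
  have "(\<Sum>S\<in>Pow A. (-1) ^ card S :: int) = (\<Prod>x\<in>A. 1 - 1)"
    using prod_diff_conv_sum[OF assms, of "\<lambda>_. 1 :: int" "\<lambda>_. 1"] by simp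
  then show ?thesis using assms by (simp add: power_0_left)
qed

lemma sum_Pow_by_card:
  fixes h :: "nat \<Rightarrow> int"
  assumes "finite A"
  shows "(\<Sum>S\<in>Pow A. h (card S)) = (\<Sum>i=0..card A. int (card A choose i) * h i)"
proof -
  have "(\<Sum>S\<in>Pow A. h (card S)) = (\<Sum>i=0..card A. \<Sum>S | S \<in> Pow A \<and> card S = i. h (card S))"
    using assms by (intro sum.group[symmetric]) (auto intro: card_mono)
  also have "\<dots> = (\<Sum>i=0..card A. int (card A choose i) * h i)"
    using n_subsets[OF assms] by (intro sum.cong) auto
  finally show ?thesis .
qed

section \<open>Finiteness\<close>

text \<open>The parts are at least \<open>1\<close>, so a partition of \<open>m\<close> has at most \<open>m\<close> parts, each of size at
  most \<open>m\<close>.\<close>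

lemma finite_colored_bary_partitions:
  assumes "b \<ge> 1"
  shows "finite (colored_bary_partitions b \<rho> m)"
proof (rule finite_subset)
  show "colored_bary_partitions b \<rho> m \<subseteq> (\<Union>k\<le>m. multisets_of_size ({..m} \<times> {1..\<rho>}) k)"
  proof
    fix P assume P: "P \<in> colored_bary_partitions b \<rho> m"
    then have sum: "sum_mset (image_mset fst P) = m"
      by (simp add: colored_bary_partitions_def)
    have pos: "1 \<le> fst x" if "x \<in># P" for x
      using P that assms by (force simp: colored_bary_partitions_def)
    have "size P = (\<Sum>x\<in>#P. 1)" by simp
    also have "\<dots> \<le> (\<Sum>x\<in>#P. fst x)" by (rule sum_mset_mono) (rule pos)
    finally have "size P \<le> m" using sum by simp
    moreover have "fst x \<le> m" if "x \<in># P" for x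
    proof -
      from that obtain Q where "P = add_mset x Q" by (blast dest: multi_member_split)
      then show ?thesis using sum by auto
    qed
    then have "set_mset P \<subseteq> {..m} \<times> {1..\<rho>}"
      using P by (force simp: colored_bary_partitions_def)
    ultimately show "P \<in> (\<Union>k\<le>m. multisets_of_size ({..m} \<times> {1..\<rho>}) k)"
      by (auto simp: multisets_of_size_def)
  qed
qed auto

section \<open>Inclusion-exclusion over the colors of the unit parts\<close>

definition unit_part_colors :: "(nat \<times> nat) multiset \<Rightarrow> nat set" where
  "unit_part_colors P = {c. (1, c) \<in># P}"

text \<open>Adding one unit part in each color of \<open>S\<close> is a bijection, whose inverse removes these parts
  again. If \<open>S\<close> has more than \<open>m\<close> colors, then a partition of \<open>m\<close> is too small to contain that
  many unit parts, in agreement with the value \<open>0\<close> at negative arguments.\<close>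

lemma card_partitions_with_unit_parts:
  assumes S: "S \<subseteq> {1..\<rho>}"
  shows "int (card {P \<in> colored_bary_partitions b \<rho> m. S \<subseteq> unit_part_colors P})
           = num_colored_bary_partitions b \<rho> (int m - int (card S))"
proof -
  define U where "U = mset_set (Pair (1::nat) ` S)"
  have fin: "finite S" using S finite_subset by blast
  have set_U: "set_mset U = Pair 1 ` S" using fin by (simp add: U_def)
  have "image_mset fst U = image_mset (\<lambda>_. 1) U"
    using set_U by (intro image_mset_cong) auto
  moreover have "size U = card S" by (simp add: U_def card_image inj_on_def)
  ultimately have sum_U: "sum_mset (image_mset fst U) = card S" by simp
  have U_le: "U \<subseteq># P" if "S \<subseteq> unit_part_colors P" for P
  proof -
    have "Pair 1 ` S \<subseteq> set_mset P" using that by (auto simp: unit_part_colors_def)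
    then have "U \<subseteq># mset_set (set_mset P)" unfolding U_def by (simp add: fin)
    then show ?thesis using mset_set_set_mset_msubset subset_mset.order_trans by blast
  qed
  have one: "\<exists>j. Suc 0 = b ^ j" by (rule exI[of _ 0]) simp
  show ?thesis
  proof (cases "card S \<le> m")
    case True
    have "bij_betw (\<lambda>Q. Q + U) (colored_bary_partitions b \<rho> (m - card S))
            {P \<in> colored_bary_partitions b \<rho> m. S \<subseteq> unit_part_colors P}"
    proof (rule bij_betw_byWitness[where f' = "\<lambda>P. P - U"])
      show "\<forall>Q\<in>colored_bary_partitions b \<rho> (m - card S). Q + U - U = Q" by simp
      show "\<forall>P\<in>{P \<in> colored_bary_partitions b \<rho> m. S \<subseteq> unit_part_colors P}. P - U + U = P"
        using U_le by simp
      show "(\<lambda>Q. Q + U) ` colored_bary_partitions b \<rho> (m - card S)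
              \<subseteq> {P \<in> colored_bary_partitions b \<rho> m. S \<subseteq> unit_part_colors P}"
        using True S
        by (auto simp: colored_bary_partitions_def unit_part_colors_def set_U sum_U one; fastforce)
      show "(\<lambda>P. P - U) ` {P \<in> colored_bary_partitions b \<rho> m. S \<subseteq> unit_part_colors P}
              \<subseteq> colored_bary_partitions b \<rho> (m - card S)"
        by (auto simp: colored_bary_partitions_def image_mset_Diff U_le sum_mset_diff sum_U
              image_mset_subseteq_mono dest: in_diffD)
    qed
    from bij_betw_same_card[OF this] True show ?thesis
      by (simp add: num_colored_bary_partitions_def nat_diff_distrib)
  next
    case False
    have "card S \<le> m" if P: "P \<in> colored_bary_partitions b \<rho> m" "S \<subseteq> unit_part_colors P" for P
    proof -
      obtain Q where "P = U + Q"
        using U_le[OF P(2)] by (blast dest: subset_mset.le_iff_add[THEN iffD1])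
      then show ?thesis using P(1) sum_U by (auto simp: colored_bary_partitions_def)
    qed
    then have "{P \<in> colored_bary_partitions b \<rho> m. S \<subseteq> unit_part_colors P} = {}"
      using False by auto
    then have "card {P \<in> colored_bary_partitions b \<rho> m. S \<subseteq> unit_part_colors P} = 0"
      by (simp only: card.empty)
    then show ?thesis using False by (simp add: num_colored_bary_partitions_def)
  qed
qed

text \<open>Exchanging the sum over color sets with the sum over partitions leaves, for each partition,
  the alternating sum over the subsets of \<open>unit_part_colors\<close>, which is \<open>0\<close> unless that set is
  empty.\<close>

lemma alternating_sum_eq_card_without_unit_parts:
  assumes "b \<ge> 1"
  shows "(\<Sum>i=0..\<rho>. (-1) ^ i * int (\<rho> choose i) *
            num_colored_bary_partitions b \<rho> (int m - int i))
          = int (card {P \<in> colored_bary_partitions b \<rho> m. unit_part_colors P = {}})"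
proof -
  let ?A = "colored_bary_partitions b \<rho> m"
  have fin: "finite ?A" using assms by (rule finite_colored_bary_partitions)
  have colors: "unit_part_colors P \<subseteq> {1..\<rho>}" if "P \<in> ?A" for P
    using that by (auto simp: colored_bary_partitions_def unit_part_colors_def)
  have "(\<Sum>i=0..\<rho>. (-1) ^ i * int (\<rho> choose i) *
            num_colored_bary_partitions b \<rho> (int m - int i))
      = (\<Sum>S\<in>Pow {1..\<rho>}. (-1) ^ card S *
            num_colored_bary_partitions b \<rho> (int m - int (card S)))"
    using sum_Pow_by_card[of "{1..\<rho>}"
        "\<lambda>i. (-1) ^ i * num_colored_bary_partitions b \<rho> (int m - int i)"]
    by (simp add: mult_ac)
  also have "\<dots> = (\<Sum>S\<in>Pow {1..\<rho>}. (-1) ^ card S *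
                    int (card {P \<in> ?A. S \<subseteq> unit_part_colors P}))"
    by (intro sum.cong) (auto simp: card_partitions_with_unit_parts)
  also have "\<dots> = (\<Sum>S\<in>Pow {1..\<rho>}. \<Sum>P | P \<in> ?A \<and> S \<subseteq> unit_part_colors P. (-1) ^ card S)"
    by (simp add: mult.commute)
  also have "\<dots> = (\<Sum>P\<in>?A. \<Sum>S | S \<in> Pow {1..\<rho>} \<and> S \<subseteq> unit_part_colors P. (-1) ^ card S)"
    using fin by (intro sum.swap_restrict) auto
  also have "\<dots> = (\<Sum>P\<in>?A. \<Sum>S\<in>Pow (unit_part_colors P). (-1) ^ card S)"
    using colors by (intro sum.cong refl) blast
  also have "\<dots> = (\<Sum>P\<in>?A. if unit_part_colors P = {} then 1 else 0)"
    using colors by (intro sum.cong refl sum_Pow_alternating) (auto intro: finite_subset)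
  also have "\<dots> = int (card {P \<in> ?A. unit_part_colors P = {}})"
    using fin by (simp add: sum.If_cases Int_def)
  finally show ?thesis .
qed

section \<open>Partitions without unit parts\<close>

definition scale_parts :: "nat \<Rightarrow> (nat \<times> nat) multiset \<Rightarrow> (nat \<times> nat) multiset" where
  "scale_parts b = image_mset (\<lambda>(p, c). (b * p, c))"

lemma sum_scale_parts:
  "sum_mset (image_mset fst (scale_parts b Q)) = b * sum_mset (image_mset fst Q)"
  by (induction Q) (auto simp: scale_parts_def algebra_simps)

lemma inj_scale_parts:
  assumes "b \<ge> 1"
  shows "inj (scale_parts b)"
  unfolding scale_parts_def using assms
  by (intro multiset.inj_map) (auto simp: inj_def)

lemma scale_parts_partition:
  assumes "b \<ge> 2" and "Q \<in> colored_bary_partitions b \<rho> n"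
  shows "scale_parts b Q \<in> colored_bary_partitions b \<rho> (b * n)"
    and "unit_part_colors (scale_parts b Q) = {}"
proof -
  have "\<exists>k. b * b ^ j = b ^ k" for j by (rule exI[of _ "Suc j"]) simp
  moreover have "sum_mset (image_mset fst (scale_parts b Q)) = b * n"
    using assms(2) by (simp add: sum_scale_parts colored_bary_partitions_def)
  ultimately show "scale_parts b Q \<in> colored_bary_partitions b \<rho> (b * n)"
    using assms(2) by (fastforce simp: colored_bary_partitions_def scale_parts_def)
  show "unit_part_colors (scale_parts b Q) = {}"
    using assms(1) by (auto simp: unit_part_colors_def scale_parts_def)
qed

text \<open>A part \<open>b ^ j\<close> other than \<open>1\<close> has \<open>j \<ge> 1\<close>, so dividing it by \<open>b\<close> leaves a power of \<open>b\<close>.\<close>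

lemma partition_without_unit_parts_is_scaled:
  assumes "b \<ge> 2" and P: "P \<in> colored_bary_partitions b \<rho> m" and "unit_part_colors P = {}"
  obtains n Q where "m = b * n" "Q \<in> colored_bary_partitions b \<rho> n" "P = scale_parts b Q"
proof -
  define Q where "Q = image_mset (\<lambda>(p, c). (p div b, c)) P"
  have part: "\<exists>j. p = b * b ^ j \<and> c \<in> {1..\<rho>}" if pc: "(p, c) \<in># P" for p c
  proof -
    obtain j where j: "p = b ^ j" "c \<in> {1..\<rho>}"
      using P pc by (auto simp: colored_bary_partitions_def)
    have "p \<noteq> 1" using pc assms(3) by (auto simp: unit_part_colors_def)
    then show ?thesis using j by (cases j) auto
  qed
  have "scale_parts b Q = image_mset (\<lambda>(p, c). (b * (p div b), c)) P"
    by (simp add: scale_parts_def Q_def image_mset.compositionality o_def case_prod_unfold)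
  also have "\<dots> = image_mset id P"
    by (intro image_mset_cong) (auto dest!: part)
  finally have PQ: "P = scale_parts b Q" by simp
  have "Q \<in> colored_bary_partitions b \<rho> (sum_mset (image_mset fst Q))"
    using \<open>b \<ge> 2\<close> by (auto simp: colored_bary_partitions_def Q_def dest!: part)
  moreover have "m = b * sum_mset (image_mset fst Q)"
    using P PQ sum_scale_parts[of b Q] by (simp add: colored_bary_partitions_def)
  ultimately show thesis using PQ that by blast
qed

lemma card_partitions_without_unit_parts:
  assumes "b \<ge> 2"
  shows "card {P \<in> colored_bary_partitions b \<rho> (b * n). unit_part_colors P = {}}
           = card (colored_bary_partitions b \<rho> n)"
proof -
  have "{P \<in> colored_bary_partitions b \<rho> (b * n). unit_part_colors P = {}}
          = scale_parts b ` colored_bary_partitions b \<rho> n" (is "?L = ?R")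
  proof
    show "?L \<subseteq> ?R"
    proof
      fix P assume "P \<in> ?L"
      then obtain k Q where "b * n = b * k" "Q \<in> colored_bary_partitions b \<rho> k"
          "P = scale_parts b Q"
        using partition_without_unit_parts_is_scaled[OF assms] by blast
      then show "P \<in> ?R" using assms by auto
    qed
    show "?R \<subseteq> ?L" using scale_parts_partition[OF assms] by blast
  qed
  moreover have "inj_on (scale_parts b) (colored_bary_partitions b \<rho> n)"
    using inj_scale_parts[of b] assms by (auto intro: inj_on_subset)
  ultimately show ?thesis by (simp add: card_image)
qed

section \<open>The recurrences\<close>

theorem proposition6p5:
  fixes b \<rho> n :: nat
  assumes "b \<ge> 2" and "\<rho> \<ge> 1"
  shows "(\<Sum>i=0..\<rho>. (-1) ^ i * int (\<rho> choose i) *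
            num_colored_bary_partitions b \<rho> (int b * int n - int i))
          = num_colored_bary_partitions b \<rho> (int n) \<and>
         (\<forall>r::nat. 1 \<le> r \<and> r \<le> b - 1 \<longrightarrow>
          (\<Sum>i=0..\<rho>. (-1) ^ i * int (\<rho> choose i) *
            num_colored_bary_partitions b \<rho> (int b * int n + int r - int i)) = 0)"
proof (intro conjI allI impI)
  have "b \<ge> 1" using assms(1) by simp
  note alternating = alternating_sum_eq_card_without_unit_parts[OF this, of \<rho>]
  show "(\<Sum>i=0..\<rho>. (-1) ^ i * int (\<rho> choose i) *
            num_colored_bary_partitions b \<rho> (int b * int n - int i))
          = num_colored_bary_partitions b \<rho> (int n)"
    using alternating[of "b * n"] card_partitions_without_unit_parts[OF assms(1), of \<rho> n]
    by (simp add: num_colored_bary_partitions_def)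
  fix r :: nat assume r: "1 \<le> r \<and> r \<le> b - 1"
  have "r < b" using r assms(1) by linarith
  then have "(b * n + r) mod b \<noteq> 0" using r by simp
  then have "\<not> b dvd b * n + r" by (simp only: dvd_eq_mod_eq_0 not_False_eq_True)
  then have "{P \<in> colored_bary_partitions b \<rho> (b * n + r). unit_part_colors P = {}} = {}"
    using partition_without_unit_parts_is_scaled[OF assms(1)]
    by (metis (mono_tags, lifting) dvd_triv_left empty_Collect_eq)
  then have "card {P \<in> colored_bary_partitions b \<rho> (b * n + r). unit_part_colors P = {}} = 0"
    by (simp only: card.empty)
  then show "(\<Sum>i=0..\<rho>. (-1) ^ i * int (\<rho> choose i) *
            num_colored_bary_partitions b \<rho> (int b * int n + int r - int i)) = 0"
    using alternating[of "b * n + r"] by simp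
qed

end
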